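(* Let $\omega=\sqrt{-2}$, let $\varepsilon\in\{1,-1\}$, and put $z=1+2\varepsilon\omega$. For every $n\in\mathbb{Z}$, the set $$S_n=\{1,\; n^2-1-2\varepsilon\omega,\; n^2+2n-2\varepsilon\omega\}$$ is a $D(z)$-triple in $\mathbb{Z}[\omega]$, and it cannot be extended to a $D(z)$-quadruple in $\mathbb{Z}[\omega]$; that is, there is no $d\in\mathbb{Z}[\omega]$ such that $S_n\cup\{d\}$ is a $D(z)$-quadruple.
   Context: $\mathbb{Z}[\omega]=\{p+q\omega : p,q\in\mathbb{Z}\}$ with $\omega=\sqrt{-2}$. For $z\in\mathbb{Z}[\omega]$ and a positive integer $m$, a $D(z)$-$m$-tuple in $\mathbb{Z}[\omega]$ is a set $\{a_1,\dots,a_m\}$ of $m$ distinct nonzero elements of $\mathbb{Z}[\omega]$ such that $a_ia_j+z$ is a square of an element of $\mathbb{Z}[\omega]$ for all $1\le i<j\le m$. A $D(z)$-triple is the case $m=3$, and a $D(z)$-quadruple is the case $m=4$. *)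

theory Defs
  imports Complex_Main
begin

definition omega :: complex where
  "omega = csqrt (-2)"

definition Zomega :: "complex set" where
  "Zomega = {of_int p + of_int q * omega | p q :: int. True}"

definition D_tuple :: "complex \<Rightarrow> nat \<Rightarrow> complex set \<Rightarrow> bool" where
  "D_tuple z m A \<longleftrightarrow>
     finite A \<and> card A = m \<and> A \<subseteq> Zomega - {0} \<and>
     (\<forall>a\<in>A. \<forall>b\<in>A. a \<noteq> b \<longrightarrow> (\<exists>w\<in>Zomega. a * b + z = w\<^sup>2))"

abbreviation D_triple :: "complex \<Rightarrow> complex set \<Rightarrow> bool" where
  "D_triple z A \<equiv> D_tuple z 3 A"

abbreviation D_quadruple :: "complex \<Rightarrow> complex set \<Rightarrow> bool" where
  "D_quadruple z A \<equiv> D_tuple z 4 A"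

end

theory Submission
  imports Defs
begin

text \<open>
  Write \<open>\<omega>\<close> for \<^const>\<open>omega\<close>. The elements of the set other than 1 are \<open>n\<^sup>2 - z\<close> and
  \<open>(n + 1)\<^sup>2 - z\<close>, so the triple property rests on the polynomial identity
  \<open>(n\<^sup>2 - z) * ((n + 1)\<^sup>2 - z) + z = (n * (n + 1) - z)\<^sup>2\<close>.

  The obstruction to a fourth element \<open>d = u + v * \<omega>\<close> lives at the prime above 2. The
  substitution \<open>n \<mapsto> - 1 - n\<close> exchanges the two elements, so let \<open>n\<close> be even. Then they are
  \<open>b = B - 2 * \<epsilon> * \<omega>\<close> with \<open>B\<close> odd and \<open>c = C - 2 * \<epsilon> * \<omega>\<close> with \<open>C\<close> divisible by 4, and
  three conditions contradict each other. If \<open>c * d + z\<close> is a square, then \<open>u\<close> is odd. Given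
  this, if \<open>d + z\<close> is a square, then \<open>v\<close> is congruent to 2 modulo 4. But then \<open>b * d + z\<close>
  has even rational part and \<open>\<omega>\<close>-coefficient congruent to 2 modulo 4, whereas a square
  \<open>(P + Q * \<omega>)\<^sup>2 = P\<^sup>2 - 2 * Q\<^sup>2 + 2 * P * Q * \<omega>\<close> with even rational part has \<open>P\<close> even and
  hence \<open>\<omega>\<close>-coefficient divisible by 4. The lemma \<open>no_common_extension_coordinates\<close> carries
  out this argument in integer coordinates.
\<close>

section \<open>Coordinates in the ring\<close>

lemma omega_square: "omega\<^sup>2 = -2"
  unfolding omega_def by (rule power2_csqrt)

lemma Zomega_coordinates_eq_iff:
  "of_int p + of_int q * omega = of_int r + of_int s * omega \<longleftrightarrow> p = r \<and> q = s"
proof -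
  have "Re omega = 0" "Im omega \<noteq> 0"
    by (simp_all add: omega_def)
  then show ?thesis
    by (auto simp: complex_eq_iff)
qed

lemma mult_coordinates:
  "(of_int a + of_int b * omega) * (of_int u + of_int v * omega)
     = of_int (a * u - 2 * b * v) + of_int (a * v + b * u) * omega"
proof -
  have "(of_int a + of_int b * omega) * (of_int u + of_int v * omega)
     = of_int (a * u) + of_int (b * v) * omega\<^sup>2 + of_int (a * v + b * u) * omega"
    by (simp add: algebra_simps power2_eq_square)
  then show ?thesis
    by (simp add: omega_square algebra_simps)
qed

lemma affine_square_coordinates:
  assumes "w \<in> Zomega"
    and "(of_int a + of_int b * omega) * (of_int u + of_int v * omega)
           + (of_int e + of_int f * omega) = w\<^sup>2"
  obtains p q :: int
  where "a * u - 2 * b * v + e = p\<^sup>2 - 2 * q\<^sup>2" and "a * v + b * u + f = 2 * p * q"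
proof -
  obtain p q :: int where w: "w = of_int p + of_int q * omega"
    using assms(1) by (auto simp: Zomega_def)
  have "of_int (a * u - 2 * b * v + e) + of_int (a * v + b * u + f) * omega = w\<^sup>2"
    unfolding assms(2)[symmetric] mult_coordinates by (simp add: algebra_simps)
  also have "w\<^sup>2 = of_int (p * p - 2 * q * q) + of_int (p * q + q * p) * omega"
    unfolding w power2_eq_square mult_coordinates ..
  finally show ?thesis
    using that[of p q] unfolding Zomega_coordinates_eq_iff
    by (simp add: power2_eq_square mult.commute)
qed

section \<open>The obstruction at 2\<close>

text \<open>
  The hypotheses in \<open>s, t\<close>, in \<open>p, q\<close> and in \<open>P, Q\<close> say that \<open>d + z\<close>, \<open>c * d + z\<close> and
  \<open>b * d + z\<close> are squares, for \<open>z = 1 + 2 * e * \<omega>\<close>, \<open>b = B - 2 * e * \<omega>\<close> and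
  \<open>c = C - 2 * e * \<omega>\<close>.
\<close>
lemma no_common_extension_coordinates:
  fixes B C u v e s t p q P Q :: int
  assumes "odd e" "odd B" "4 dvd C"
    and d1: "u + 1 = s\<^sup>2 - 2 * t\<^sup>2" and d2: "v + 2 * e = 2 * s * t"
    and c1: "C * u + 4 * e * v + 1 = p\<^sup>2 - 2 * q\<^sup>2"
    and c2: "C * v - 2 * e * u + 2 * e = 2 * p * q"
    and b1: "B * u + 4 * e * v + 1 = P\<^sup>2 - 2 * Q\<^sup>2"
    and b2: "B * v - 2 * e * u + 2 * e = 2 * P * Q"
  shows False
proof -
  obtain k where k: "C = 4 * k"
    using \<open>4 dvd C\<close> by (elim dvdE)
  define h where "h = s * t - e"
  have v: "v = 2 * h"
    using d2 by (simp add: h_def)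
  have p: "p\<^sup>2 = 1 + 2 * (2 * (k * u + e * v) + q\<^sup>2)"
    using c1 k by (simp add: algebra_simps)
  then have "odd (p\<^sup>2)"
    by simp
  then obtain m where m: "p = 2 * m + 1"
    by (auto elim: oddE)
  \<comment> \<open>The square of an odd number is 1 modulo 4, which forces \<open>2 * q\<^sup>2\<close> into the multiples of 4.\<close>
  have "q\<^sup>2 = 2 * (m\<^sup>2 + m - k * u - e * v)"
    using p m by (simp add: power2_eq_square algebra_simps)
  then have "even (q\<^sup>2)"
    by simp
  then have "even q"
    by simp
  have "p * q = 2 * (k * v) - e * u + e"
    using c2 k by (simp add: algebra_simps)
  then have "even (2 * (k * v) - e * u + e)"
    using \<open>even q\<close> by (metis even_mult_iff)
  then have "odd u"
    using \<open>odd e\<close> by simp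
  then have "even (s\<^sup>2 - 2 * t\<^sup>2)"
    unfolding d1[symmetric] by simp
  then have "odd h"
    using \<open>odd e\<close> by (simp add: h_def)
  have "P * Q = B * h - e * u + e"
    using b2 v by (simp add: algebra_simps)
  moreover have "odd (B * h - e * u + e)"
    using \<open>odd h\<close> \<open>odd u\<close> \<open>odd e\<close> \<open>odd B\<close> by simp
  ultimately have "odd P"
    by (metis even_mult_iff)
  then have "odd (P\<^sup>2 - 2 * Q\<^sup>2)"
    by simp
  then show False
    using \<open>odd u\<close> \<open>odd B\<close> unfolding b1[symmetric] by simp
qed

lemma no_common_extension_even:
  fixes \<epsilon> n :: int and z d :: complex
  assumes "odd \<epsilon>" "even n" and z: "z = 1 + 2 * of_int \<epsilon> * omega"
    and "d \<in> Zomega"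
    and sq1: "\<exists>w\<in>Zomega. 1 * d + z = w\<^sup>2"
    and sqb: "\<exists>w\<in>Zomega. (of_int (n\<^sup>2 - 1) - 2 * of_int \<epsilon> * omega) * d + z = w\<^sup>2"
    and sqc: "\<exists>w\<in>Zomega. (of_int (n\<^sup>2 + 2 * n) - 2 * of_int \<epsilon> * omega) * d + z = w\<^sup>2"
  shows False
proof -
  obtain u v :: int where d: "d = of_int u + of_int v * omega"
    using \<open>d \<in> Zomega\<close> by (auto simp: Zomega_def)
  have z': "z = of_int 1 + of_int (2 * \<epsilon>) * omega"
    by (simp add: z)
  have one: "1 = of_int 1 + of_int 0 * omega"
    by simp
  have bc: "of_int k - 2 * of_int \<epsilon> * omega = of_int k + of_int (-2 * \<epsilon>) * omega" for k
    by simp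
  obtain s t where "1 * u - 2 * 0 * v + 1 = s\<^sup>2 - 2 * t\<^sup>2" "1 * v + 0 * u + 2 * \<epsilon> = 2 * s * t"
    using sq1 unfolding d z' by (subst (asm) one) (elim bexE affine_square_coordinates)
  moreover obtain P Q where
    "(n\<^sup>2 - 1) * u - 2 * (-2 * \<epsilon>) * v + 1 = P\<^sup>2 - 2 * Q\<^sup>2"
    "(n\<^sup>2 - 1) * v + (-2 * \<epsilon>) * u + 2 * \<epsilon> = 2 * P * Q"
    using sqb unfolding d z' bc by (elim bexE affine_square_coordinates)
  moreover obtain p q where
    "(n\<^sup>2 + 2 * n) * u - 2 * (-2 * \<epsilon>) * v + 1 = p\<^sup>2 - 2 * q\<^sup>2"
    "(n\<^sup>2 + 2 * n) * v + (-2 * \<epsilon>) * u + 2 * \<epsilon> = 2 * p * q"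
    using sqc unfolding d z' bc by (elim bexE affine_square_coordinates)
  moreover have "odd (n\<^sup>2 - 1)" "4 dvd n\<^sup>2 + 2 * n"
    using \<open>even n\<close> by (auto elim!: evenE simp: power2_eq_square)
  ultimately show False
    using no_common_extension_coordinates[of \<epsilon> "n\<^sup>2 - 1" "n\<^sup>2 + 2 * n" u s t v p q P Q] \<open>odd \<epsilon>\<close>
    by simp
qed

section \<open>The triples and their maximality\<close>

theorem mainTheorem2:
  fixes \<epsilon> n :: int and z :: complex and S :: "complex set"
  assumes "\<epsilon> \<in> {1, -1}"
    and "z = 1 + 2 * of_int \<epsilon> * omega"
    and "S = {1,
              of_int (n\<^sup>2 - 1) - 2 * of_int \<epsilon> * omega,
              of_int (n\<^sup>2 + 2 * n) - 2 * of_int \<epsilon> * omega}"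
  shows "D_triple z S \<and> \<not> (\<exists>d\<in>Zomega. D_quadruple z (S \<union> {d}))"
proof -
  define b c :: complex
    where "b = of_int (n\<^sup>2 - 1) - 2 * of_int \<epsilon> * omega"
      and "c = of_int (n\<^sup>2 + 2 * n) - 2 * of_int \<epsilon> * omega"
  have S: "S = {1, b, c}"
    by (simp add: assms(3) b_def c_def)
  have coords: "b = of_int (n\<^sup>2 - 1) + of_int (-2 * \<epsilon>) * omega"
    "c = of_int (n\<^sup>2 + 2 * n) + of_int (-2 * \<epsilon>) * omega"
    "1 = of_int 1 + of_int 0 * omega" "0 = of_int 0 + of_int 0 * omega"
    "z = of_int 1 + of_int (2 * \<epsilon>) * omega"
    by (simp_all add: b_def c_def assms(2))
  have "odd \<epsilon>"
    using assms(1) by auto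
  have mem: "of_int x + of_int y * omega \<in> Zomega" for x y
    by (auto simp: Zomega_def)
  have "n\<^sup>2 - 1 \<noteq> n\<^sup>2 + 2 * n"
    by presburger
  moreover have "-2 * \<epsilon> \<noteq> 0"
    using \<open>odd \<epsilon>\<close> by auto
  ultimately have distinct: "b \<noteq> c" "b \<noteq> 1" "c \<noteq> 1" "b \<noteq> 0" "c \<noteq> 0"
    unfolding coords Zomega_coordinates_eq_iff by blast+
  then have card: "card S = 3"
    by (simp add: S)
  have S_sub: "S \<subseteq> Zomega - {0}"
    using distinct mem[of 1 0] mem[of "n\<^sup>2 - 1" "-2 * \<epsilon>"] mem[of "n\<^sup>2 + 2 * n" "-2 * \<epsilon>"]
    unfolding S coords(1,2)[symmetric] by simp
  have bz: "b = of_int n ^ 2 - z" and cz: "c = (of_int n + 1) ^ 2 - z"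
    by (simp_all add: b_def c_def assms(2) power2_eq_square algebra_simps)
  have "D_triple z S"
  proof -
    have "1 * b + z = (of_int n + of_int 0 * omega)\<^sup>2"
      "1 * c + z = (of_int (n + 1) + of_int 0 * omega)\<^sup>2"
      by (simp_all add: bz cz)
    moreover have "b * c + z = (of_int (n * (n + 1) - 1) + of_int (-2 * \<epsilon>) * omega)\<^sup>2"
    proof -
      have "b * c + z = (of_int (n * (n + 1)) - z)\<^sup>2"
        by (simp add: bz cz power2_eq_square algebra_simps)
      then show ?thesis
        by (simp add: assms(2) algebra_simps)
    qed
    ultimately have "\<exists>w\<in>Zomega. 1 * b + z = w\<^sup>2" "\<exists>w\<in>Zomega. 1 * c + z = w\<^sup>2"
      "\<exists>w\<in>Zomega. b * c + z = w\<^sup>2"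
      using mem by blast+
    then have "\<forall>x\<in>S. \<forall>y\<in>S. x \<noteq> y \<longrightarrow> (\<exists>w\<in>Zomega. x * y + z = w\<^sup>2)"
      by (simp add: S mult.commute)
    then show ?thesis
      using card S_sub by (simp add: D_tuple_def S)
  qed
  moreover have False if "d \<in> Zomega" and D: "D_quadruple z (S \<union> {d})" for d
  proof -
    have "d \<notin> S"
    proof
      assume "d \<in> S"
      then have "S \<union> {d} = S"
        by blast
      then show False
        using D card by (simp add: D_tuple_def)
    qed
    then have "x \<noteq> d" if "x \<in> S" for x
      using that by auto
    then have sq: "\<exists>w\<in>Zomega. x * d + z = w\<^sup>2" if "x \<in> S" for x
      using D that by (simp add: D_tuple_def)
    have sq1: "\<exists>w\<in>Zomega. 1 * d + z = w\<^sup>2"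
      and sqb: "\<exists>w\<in>Zomega. b * d + z = w\<^sup>2" and sqc: "\<exists>w\<in>Zomega. c * d + z = w\<^sup>2"
      by (rule sq, simp add: S)+
    show False
    proof (cases "even n")
      case True
      show False
        by (rule no_common_extension_even[OF \<open>odd \<epsilon>\<close> True assms(2) \<open>d \<in> Zomega\<close> sq1
              sqb[unfolded b_def] sqc[unfolded c_def]])
    next
      case False
      have "b = of_int ((- 1 - n)\<^sup>2 + 2 * (- 1 - n)) - 2 * of_int \<epsilon> * omega"
        "c = of_int ((- 1 - n)\<^sup>2 - 1) - 2 * of_int \<epsilon> * omega"
        by (simp_all add: b_def c_def power2_eq_square algebra_simps)
      moreover have "even (- 1 - n)"
        using False by simp
      ultimately show False
        using no_common_extension_even[of \<epsilon> "- 1 - n" z d] \<open>odd \<epsilon>\<close> assms(2) \<open>d \<in> Zomega\<close>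
          sq1 sqb sqc
        by metis
    qed
  qed
  ultimately show ?thesis
    by blast
qed

end
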